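(* Assume GCH. If $X$ is a homogeneous compactum, then $\chi Nt(X)\leq c(X)$, where $c(X)$ is the cellularity of $X$.
   Context: A compactum is a compact Hausdorff space. Families of open sets are ordered by inclusion; a poset is $\kappa^{\mathrm{op}}$-like if no element is below $\kappa$-many elements. For a point $p\in X$, $\chi Nt(p,X)$ is the least $\kappa\geq\omega$ such that $p$ has a $\kappa^{\mathrm{op}}$-like local base, and $\chi Nt(X)=\sup_{p\in X}\chi Nt(p,X)$. *)

theory Defs
  imports "HOL-Analysis.Analysis" "HOL-Library.Equipollence"
begin

text \<open>Cardinals are represented by sets (a set K stands for the cardinal |K|);
  comparison is via lepoll. "kappa >= omega" means K is infinite.\<close>

definition GCH_upto :: "'b itself \<Rightarrow> bool" where
  "GCH_upto _ \<longleftrightarrow> (\<forall>A::'b set. infinite A \<longrightarrow>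
      (\<forall>B. B \<subseteq> Pow A \<longrightarrow> A \<lesssim> B \<longrightarrow> B \<approx> A \<or> B \<approx> Pow A))"

definition homogeneous_space :: "'a topology \<Rightarrow> bool" where
  "homogeneous_space X \<longleftrightarrow> (\<forall>p\<in>topspace X. \<forall>q\<in>topspace X.
      \<exists>f. homeomorphic_map X X f \<and> f p = q)"

definition local_base :: "'a topology \<Rightarrow> 'a \<Rightarrow> 'a set set \<Rightarrow> bool" where
  "local_base X p B \<longleftrightarrow> p \<in> topspace X \<and> (\<forall>U\<in>B. openin X U \<and> p \<in> U) \<and>
      (\<forall>W. openin X W \<and> p \<in> W \<longrightarrow> (\<exists>U\<in>B. U \<subseteq> W))"

definition op_like :: "'k set \<Rightarrow> 'a set set \<Rightarrow> bool" where
  "op_like K B \<longleftrightarrow> (\<forall>U\<in>B. \<not> (K \<lesssim> {V\<in>B. U \<subseteq> V}))"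

definition is_chiNt_pt :: "'a topology \<Rightarrow> 'a \<Rightarrow> 'k set \<Rightarrow> bool" where
  "is_chiNt_pt X p K \<longleftrightarrow> infinite K \<and> (\<exists>B. local_base X p B \<and> op_like K B) \<and>
     (\<forall>K'::'k set. infinite K' \<and> (\<exists>B. local_base X p B \<and> op_like K' B) \<longrightarrow> K \<lesssim> K')"

definition is_chiNt :: "'a topology \<Rightarrow> 'k set \<Rightarrow> bool" where
  "is_chiNt X K \<longleftrightarrow>
     (\<forall>p\<in>topspace X. \<exists>L::'k set. is_chiNt_pt X p L \<and> L \<lesssim> K) \<and>
     (\<forall>K'::'k set. (\<forall>p\<in>topspace X. \<exists>L::'k set. is_chiNt_pt X p L \<and> L \<lesssim> K')
         \<longrightarrow> K \<lesssim> K')"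

definition cellular_family :: "'a topology \<Rightarrow> 'a set set \<Rightarrow> bool" where
  "cellular_family X F \<longleftrightarrow> (\<forall>U\<in>F. openin X U \<and> U \<noteq> {}) \<and> pairwise disjnt F"

definition is_cellularity :: "'a topology \<Rightarrow> 'k set \<Rightarrow> bool" where
  "is_cellularity X K \<longleftrightarrow> infinite K \<and> (\<forall>F. cellular_family X F \<longrightarrow> F \<lesssim> K) \<and>
     (\<forall>K'::'k set. infinite K' \<and> (\<forall>F. cellular_family X F \<longrightarrow> F \<lesssim> K') \<longrightarrow> K \<lesssim> K')"

end

theory Submission
  imports Defs
begin

text \<open>
  By homogeneity all points have the same character \<open>\<kappa>\<close>. A well-ordered local base of size \<open>\<kappa>\<close> can be
  thinned out so that every member has fewer than \<open>\<kappa>\<close> supersets, which settles the case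
  \<open>\<kappa> \<le> c(X)\<close>. Suppose \<open>c(X) < \<kappa>\<close>.

  If the local \<open>\<pi>\<close>-character is less than \<open>\<kappa>\<close>, let \<open>\<mu> < \<kappa>\<close> be its maximum with \<open>c(X)\<close>. Then
  \<open>|X| \<le> 2\<^sup>\<mu> \<le> \<kappa>\<close>, by Shapirovskii's bound on the density, homogeneity and GCH, contradicting the
  theorem of Cech and Pospisil by which \<open>|X| > \<kappa>\<close>.

  If the local \<open>\<pi>\<close>-character equals \<open>\<kappa>\<close>, there are \<open>\<kappa>\<close> finite open covers such that any finite choice
  of members of distinct covers leaves some point uncovered. From them one gets a point with \<open>\<kappa>\<close>
  neighbourhoods of which any given neighbourhood is contained in only finitely many. Intersecting
  these with a local base indexed by \<open>\<kappa>\<close> gives one in which every member has finitely many supersets.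
\<close>

unbundle cardinal_syntax

section \<open>Cardinal arithmetic\<close>

lemma lepoll_iff_card_of: "A \<lesssim> B \<longleftrightarrow> |A| \<le>o |B|"
  unfolding lepoll_def card_of_ordLeq[symmetric] ..

lemma lesspoll_iff_card_of: "A \<prec> B \<longleftrightarrow> |A| <o |B|"
  unfolding lesspoll_def eqpoll_iff_card_of_ordIso lepoll_iff_card_of
  using ordLeq_iff_ordLess_or_ordIso not_ordLess_ordIso by blast

lemma not_lepoll_iff_lesspoll: "\<not> A \<lesssim> B \<longleftrightarrow> B \<prec> A"
  unfolding lepoll_iff_card_of lesspoll_iff_card_of
  by (rule not_ordLeq_iff_ordLess) (rule card_of_Well_order)+

lemma uncountable_of_lesspoll:
  assumes "infinite C" "C \<prec> B"
  shows "uncountable B"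
proof
  assume "countable B"
  then have "B \<lesssim> (UNIV :: nat set)" by (auto simp: countable_def lepoll_def)
  then have "B \<lesssim> C" using assms(1)[unfolded infinite_le_lepoll] by (rule lepoll_trans)
  then show False using assms(2) not_lepoll_iff_lesspoll by blast
qed

text \<open>The cardinal order \<open>|I|\<close> is a well-order of least type, so its proper
  initial segments are smaller than \<open>I\<close>. Only its strict part is kept, since that is
  the well-founded relation along which the recursions run.\<close>

lemma initial_strict_wellorder:
  fixes I :: "'i set"
  obtains R where "wf R" "total_on I R" "R \<subseteq> I \<times> I"
    "\<And>i. i \<in> I \<Longrightarrow> {j. (j, i) \<in> R} \<prec> I"
proof
  let ?r = "|I|"
  have wo: "well_order_on I ?r" by (rule card_of_well_order_on)
  then show "wf ( ?r - Id)" by (simp add: well_order_on_def)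
  show "total_on I ( ?r - Id)"
    using wo by (simp add: well_order_on_def linear_order_on_def)
  show "?r - Id \<subseteq> I \<times> I"
    using wo well_order_on_domain by fastforce
  fix i assume "i \<in> I"
  then have "|underS ?r i| <o ?r"
    using card_of_underS[OF card_of_Card_order, of i I] by (simp add: Field_card_of)
  moreover have "{j. (j, i) \<in> ?r - Id} = underS ?r i"
    by (auto simp: underS_def)
  ultimately show "{j. (j, i) \<in> ?r - Id} \<prec> I"
    by (simp add: lesspoll_iff_card_of)
qed

lemma UN_lepoll:
  assumes "infinite B" "I \<lesssim> B" "\<And>i. i \<in> I \<Longrightarrow> A i \<lesssim> B"
  shows "(\<Union>i\<in>I. A i) \<lesssim> B"
  using card_of_UNION_ordLeq_infinite[of B I A] assms by (simp add: lepoll_iff_card_of)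

lemma Times_lepoll:
  assumes "infinite B" "A \<lesssim> B" "A' \<lesssim> B"
  shows "A \<times> A' \<lesssim> B"
  using card_of_Sigma_ordLeq_infinite[of B A "\<lambda>_. A'"] assms by (simp add: lepoll_iff_card_of)

text \<open>Finite subsets are the ranges of finite lists, lists of each fixed length inject into
  \<open>A\<close> because squaring does not enlarge it, and there are countably many
  lengths.\<close>

lemma Fpow_lepoll:
  assumes "infinite A"
  shows "Fpow A \<lesssim> A"
proof -
  have *: "{xs. set xs \<subseteq> A \<and> length xs = n} \<lesssim> A" for n
  proof (induction n)
    case 0
    have "{xs. set xs \<subseteq> A \<and> length xs = 0} = {[]}" by auto
    then show ?case using assms by (simp add: finite_lepoll_infinite)
  next
    case (Suc n)
    have "{xs. set xs \<subseteq> A \<and> length xs = Suc n}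
        = (\<lambda>(x, xs). x # xs) ` (A \<times> {xs. set xs \<subseteq> A \<and> length xs = n})"
      by (force simp: length_Suc_conv image_iff)
    then show ?case
      using lepoll_trans[OF image_lepoll Times_lepoll[OF assms lepoll_refl Suc]] by simp
  qed
  have "Fpow A \<subseteq> set ` (\<Union>n. {xs. set xs \<subseteq> A \<and> length xs = n})"
  proof
    fix F assume F: "F \<in> Fpow A"
    then obtain xs where "set xs = F" by (auto simp: Fpow_def dest: finite_list)
    with F show "F \<in> set ` (\<Union>n. {xs. set xs \<subseteq> A \<and> length xs = n})"
      by (auto simp: Fpow_def)
  qed
  moreover have "(\<Union>n. {xs. set xs \<subseteq> A \<and> length xs = n}) \<lesssim> A"
    using assms * by (intro UN_lepoll) (auto simp: infinite_le_lepoll)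
  ultimately show ?thesis
    by (meson subset_image_lepoll lepoll_trans)
qed

lemma Fpow_lepoll_mono:
  assumes "A \<lesssim> B"
  shows "Fpow A \<lesssim> Fpow B"
proof -
  obtain f where f: "inj_on f A" "f ` A \<subseteq> B" using assms by (auto simp: lepoll_def)
  have "inj_on (image f) (Fpow A)" by (rule inj_on_image_Fpow[OF f(1)])
  moreover have "image f ` Fpow A \<subseteq> Fpow B" using f(2) by (auto simp: Fpow_def)
  ultimately show ?thesis by (auto simp: lepoll_def)
qed

text \<open>For uncountable \<open>A\<close> neither the product nor \<open>Fpow\<close> raises the
  cardinal. A countable, possibly finite, \<open>A\<close> still gives a countable family, and there
  the uncountability of \<open>K\<close> is what counts.\<close>

lemma Fpow_Times_nat_lesspoll:
  assumes "uncountable K" "A \<prec> K"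
  shows "Fpow (A \<times> (UNIV :: nat set)) \<prec> K"
proof (cases "countable A")
  case True
  then have "countable (Fpow (A \<times> (UNIV :: nat set)))"
    by (simp add: countable_Fpow)
  then show ?thesis
    using assms(1) countable_lepoll not_lepoll_iff_lesspoll by blast
next
  case False
  then have inf: "infinite A" "A \<noteq> {}" by (auto simp: uncountable_infinite)
  have "A \<times> (UNIV :: nat set) \<lesssim> A"
    using inf by (intro Times_lepoll) (auto simp: infinite_le_lepoll)
  moreover have "infinite (A \<times> (UNIV :: nat set))"
    using inf by (simp add: finite_cartesian_product_iff)
  ultimately show ?thesis
    using Fpow_lepoll assms(2) lepoll_trans lesspoll_trans1 by blast
qed

text \<open>Exponents multiply: a function into subsets of \<open>M\<close> is the same as a subset
  of \<open>P \<times> M\<close>, and this product is no larger than \<open>M\<close>.\<close>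

lemma Func_Pow_lepoll:
  assumes "infinite M" "P \<lesssim> M" "D \<lesssim> Pow M"
  shows "P \<rightarrow>\<^sub>E D \<lesssim> Pow M"
proof -
  obtain e where e: "inj_on e D" "e ` D \<subseteq> Pow M"
    using assms(3) by (auto simp: lepoll_def)
  let ?g = "\<lambda>f. {(i, m). i \<in> P \<and> m \<in> e (f i)}"
  have "inj_on ?g (P \<rightarrow>\<^sub>E D)"
  proof (rule inj_onI)
    fix f f' assume f: "f \<in> P \<rightarrow>\<^sub>E D" "f' \<in> P \<rightarrow>\<^sub>E D" and eq: "?g f = ?g f'"
    have "f i = f' i" if "i \<in> P" for i
    proof -
      have "e (f i) = e (f' i)" using eq that by (auto simp: set_eq_iff)
      then show ?thesis using e(1) f that by (meson PiE_mem inj_onD)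
    qed
    then show "f = f'" using f by (meson PiE_ext)
  qed
  moreover have "?g ` (P \<rightarrow>\<^sub>E D) \<subseteq> Pow (P \<times> M)"
    using e(2) by (fastforce dest: PiE_mem)
  ultimately have "P \<rightarrow>\<^sub>E D \<lesssim> Pow (P \<times> M)" by (auto simp: lepoll_def)
  also have "Pow (P \<times> M) \<lesssim> Pow M"
  proof -
    have "P \<times> M \<lesssim> M" using assms by (intro Times_lepoll) auto
    then obtain h where h: "inj_on h (P \<times> M)" "h ` (P \<times> M) \<subseteq> M" by (auto simp: lepoll_def)
    then have "inj_on (image h) (Pow (P \<times> M))" "image h ` Pow (P \<times> M) \<subseteq> Pow M"
      by (auto simp: inj_on_image_Pow)
    then show ?thesis by (auto simp: lepoll_def)
  qed
  finally show ?thesis .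
qed

text \<open>Every nonempty such \<open>W\<close> is the range of a function from \<open>M\<close> to
  \<open>S\<close>, so the functions may be counted instead.\<close>

lemma small_subsets_lepoll:
  assumes "infinite M" "S \<lesssim> Pow M"
  shows "{W. W \<subseteq> S \<and> W \<lesssim> M} \<lesssim> Pow M"
proof -
  have sub: "{W. W \<subseteq> S \<and> W \<lesssim> M} \<subseteq> insert {} ((\<lambda>f. f ` M) ` (M \<rightarrow>\<^sub>E S))"
  proof
    fix W assume W: "W \<in> {W. W \<subseteq> S \<and> W \<lesssim> M}"
    show "W \<in> insert {} ((\<lambda>f. f ` M) ` (M \<rightarrow>\<^sub>E S))"
    proof (cases "W = {}")
      case False
      then obtain g where "g ` M = W"
        using W inj_on_iff_surj[of W M] by (auto simp: lepoll_def)
      then have "restrict g M \<in> M \<rightarrow>\<^sub>E S" "W = restrict g M ` M"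
        using W by auto
      then show ?thesis by blast
    qed simp
  qed
  have "insert {} ((\<lambda>f. f ` M) ` (M \<rightarrow>\<^sub>E S)) \<lesssim> Pow M"
  proof -
    have inf: "infinite (Pow M)" using assms(1) by simp
    have "(\<lambda>f. f ` M) ` (M \<rightarrow>\<^sub>E S) \<lesssim> Pow M"
      using Func_Pow_lepoll[OF assms(1) lepoll_refl assms(2)] image_lepoll lepoll_trans by blast
    \<comment> \<open>The binary union is written as a union over the booleans so that
      \<open>UN_lepoll\<close> bounds it.\<close>
    then have "(\<Union>b\<in>UNIV. if b then {{}} else (\<lambda>f. f ` M) ` (M \<rightarrow>\<^sub>E S)) \<lesssim> Pow M"
      using inf by (intro UN_lepoll) (auto intro: finite_lepoll_infinite)
    moreover have "(\<Union>b\<in>UNIV. if b then {{}} else (\<lambda>f. f ` M) ` (M \<rightarrow>\<^sub>E S))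
        = insert {} ((\<lambda>f. f ` M) ` (M \<rightarrow>\<^sub>E S))"
      by (auto simp: UNIV_bool)
    ultimately show ?thesis by simp
  qed
  with sub show ?thesis
    using lepoll_trans[OF subset_imp_lepoll[OF sub]] by blast
qed

section \<open>Local bases with few supersets\<close>

definition local_pi_base :: "'a topology \<Rightarrow> 'a \<Rightarrow> 'a set set \<Rightarrow> bool" where
  "local_pi_base X p P \<longleftrightarrow> (\<forall>U\<in>P. openin X U \<and> U \<noteq> {}) \<and>
      (\<forall>W. openin X W \<and> p \<in> W \<longrightarrow> (\<exists>U\<in>P. U \<subseteq> W))"

section \<open>Transport of local bases along homeomorphisms\<close>

lemma homeomorphic_map_neighbourhood:
  assumes "homeomorphic_map X X f" "p \<in> topspace X" "openin X W" "f p \<in> W"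
  obtains W' where "openin X W'" "p \<in> W'" "f ` W' \<subseteq> W"
proof
  show "openin X {x \<in> topspace X. f x \<in> W}"
    using homeomorphic_imp_continuous_map[OF assms(1)] assms(3)
    by (rule openin_continuous_map_preimage)
  show "p \<in> {x \<in> topspace X. f x \<in> W}" using assms(2,4) by simp
  show "f ` {x \<in> topspace X. f x \<in> W} \<subseteq> W" by blast
qed

lemma openin_homeomorphic_image:
  "\<lbrakk>homeomorphic_map X X f; openin X U\<rbrakk> \<Longrightarrow> openin X (f ` U)"
  using homeomorphic_map_openness[of X X f U] openin_subset[of X U] by blast

lemma local_base_homeomorphic_image:
  assumes "homeomorphic_map X X f" "local_base X p B"
  shows "local_base X (f p) ((`) f ` B)"
  unfolding local_base_def
proof (intro conjI allI impI)
  have p: "p \<in> topspace X" using assms(2) by (simp add: local_base_def)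
  then show "f p \<in> topspace X"
    using homeomorphic_imp_surjective_map[OF assms(1)] by blast
  show "\<forall>U\<in>(`) f ` B. openin X U \<and> f p \<in> U"
    using assms by (auto simp: local_base_def intro: openin_homeomorphic_image)
  fix W assume "openin X W \<and> f p \<in> W"
  then obtain W' where "openin X W'" "p \<in> W'" "f ` W' \<subseteq> W"
    using homeomorphic_map_neighbourhood assms(1) p by metis
  moreover from this obtain U where "U \<in> B" "U \<subseteq> W'"
    using assms(2) by (auto simp: local_base_def)
  ultimately have "f ` U \<subseteq> W" "f ` U \<in> (`) f ` B" by auto
  then show "\<exists>U\<in>(`) f ` B. U \<subseteq> W" by (rule bexI)
qed

lemma local_pi_base_homeomorphic_image:
  assumes "homeomorphic_map X X f" "p \<in> topspace X" "local_pi_base X p P"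
  shows "local_pi_base X (f p) ((`) f ` P)"
  unfolding local_pi_base_def
proof (intro conjI allI impI)
  show "\<forall>U\<in>(`) f ` P. openin X U \<and> U \<noteq> {}"
    using assms by (auto simp: local_pi_base_def intro: openin_homeomorphic_image)
  fix W assume "openin X W \<and> f p \<in> W"
  then obtain W' where "openin X W'" "p \<in> W'" "f ` W' \<subseteq> W"
    using homeomorphic_map_neighbourhood assms(1,2) by metis
  moreover from this obtain U where "U \<in> P" "U \<subseteq> W'"
    using assms(3) by (auto simp: local_pi_base_def)
  ultimately have "f ` U \<subseteq> W" "f ` U \<in> (`) f ` P" by auto
  then show "\<exists>U\<in>(`) f ` P. U \<subseteq> W" by (rule bexI)
qed

lemma op_like_homeomorphic_image:
  assumes "homeomorphic_map X X f" "local_base X p B" "op_like K B"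
  shows "op_like K ((`) f ` B)"
  unfolding op_like_def
proof (intro ballI notI)
  fix U' assume "U' \<in> (`) f ` B" and K: "K \<lesssim> {V \<in> (`) f ` B. U' \<subseteq> V}"
  then obtain U where U: "U \<in> B" "U' = f ` U" by blast
  have sub: "V \<subseteq> topspace X" if "V \<in> B" for V
    using that assms(2) by (auto simp: local_base_def dest: openin_subset)
  have "inj_on f (topspace X)" using assms(1) homeomorphic_imp_injective_map by blast
  \<comment> \<open>Injectivity of \<open>f\<close> on the space makes an inclusion between images
    come from an inclusion between the originals.\<close>
  then have "{V \<in> (`) f ` B. U' \<subseteq> V} \<subseteq> (`) f ` {V \<in> B. U \<subseteq> V}"
    using U sub by (auto simp: inj_on_image_subset_iff)
  then have "K \<lesssim> {V \<in> B. U \<subseteq> V}"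
    using K by (meson subset_image_lepoll lepoll_trans)
  then show False using assms(3) U(1) by (auto simp: op_like_def)
qed

text \<open>Keeping only the members of a local base without a smaller member that is earlier in a
  well-order of minimal type leaves a local base in which supersets always come earlier.\<close>

lemma op_like_local_base_of_lepoll:
  assumes "local_base X p B" "B \<lesssim> C" "infinite C"
  shows "\<exists>B'. local_base X p B' \<and> op_like C B'"
proof -
  obtain R where R: "wf R" "total_on B R" "R \<subseteq> B \<times> B" "\<And>i. i \<in> B \<Longrightarrow> {j. (j, i) \<in> R} \<prec> B"
    using initial_strict_wellorder[of B] by metis
  define B' where "B' = {U \<in> B. \<forall>U'. (U', U) \<in> R \<longrightarrow> \<not> U' \<subseteq> U}"
  have "local_base X p B'"
    unfolding local_base_def
  proof (intro conjI allI impI)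
    fix W assume "openin X W \<and> p \<in> W"
    then obtain U0 where "U0 \<in> {U \<in> B. U \<subseteq> W}" using assms(1) by (auto simp: local_base_def)
    \<comment> \<open>The earliest member inside \<open>W\<close> is kept: an earlier member
      contained in it would also lie inside \<open>W\<close>.\<close>
    then obtain U where "U \<in> {U \<in> B. U \<subseteq> W}" "\<And>U'. (U', U) \<in> R \<Longrightarrow> U' \<notin> {U \<in> B. U \<subseteq> W}"
      by (rule wfE_min[OF R(1)]) blast
    then have "U \<in> B'" "U \<subseteq> W" using R(3) by (auto simp: B'_def)
    then show "\<exists>U\<in>B'. U \<subseteq> W" by blast
  next
    show "p \<in> topspace X" using assms(1) by (simp add: local_base_def)
    show "\<forall>U\<in>B'. openin X U \<and> p \<in> U" using assms(1) by (simp add: local_base_def B'_def)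
  qed
  moreover have "op_like C B'"
    unfolding op_like_def
  proof (intro ballI notI)
    fix U assume U: "U \<in> B'" and C: "C \<lesssim> {V \<in> B'. U \<subseteq> V}"
    define S where "S = {j. (j, U) \<in> R}"
    \<comment> \<open>A superset coming after \<open>U\<close> would have been discarded because of
      \<open>U\<close>.\<close>
    have sub: "{V \<in> B'. U \<subseteq> V} \<subseteq> insert U S"
      using U R(2) unfolding B'_def S_def total_on_def by blast
    have C': "C \<lesssim> insert U S" by (rule lepoll_trans[OF C subset_imp_lepoll[OF sub]])
    then have "infinite S"
      using lepoll_trans[OF assms(3)[unfolded infinite_le_lepoll] C'] by (simp flip: infinite_le_lepoll)
    then have "C \<lesssim> S" using lepoll_trans2[OF C' infinite_insert_eqpoll] by blast
    moreover have "S \<prec> B" using R(4) U by (simp add: S_def B'_def)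
    then have "S \<prec> C" using assms(2) by (rule lesspoll_trans2)
    ultimately show False using not_lepoll_iff_lesspoll by blast
  qed
  ultimately show ?thesis by blast
qed

section \<open>Independent covers and a point with independent neighbourhoods\<close>

text \<open>Zorn's lemma applies because each \<open>T\<close> is compact: if the union of a chain
  covered \<open>T\<close>, a single member of the chain would. The last clause is maximality,
  tested against \<open>U \<union> W\<close>.\<close>

lemma maximal_open_not_covering:
  assumes "compact_space X" "\<And>T. T \<in> \<T> \<Longrightarrow> closedin X T \<and> T \<noteq> {}"
  shows "\<exists>U. openin X U \<and> (\<forall>T\<in>\<T>. \<not> T \<subseteq> U) \<and>
    (\<forall>W. openin X W \<and> \<not> W \<subseteq> U \<longrightarrow> (\<exists>T\<in>\<T>. T \<subseteq> U \<union> W))"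
proof -
  define A where "A = {U. openin X U \<and> (\<forall>T\<in>\<T>. \<not> T \<subseteq> U)}"
  have "{} \<in> A" using assms(2) by (auto simp: A_def)
  moreover have "\<Union>\<C> \<in> A" if \<C>: "\<C> \<noteq> {}" "subset.chain A \<C>" for \<C>
  proof -
    have op: "openin X U" if "U \<in> \<C>" for U
      using that \<C>(2) by (auto simp: A_def subset_chain_def)
    have "\<not> T \<subseteq> \<Union>\<C>" if T: "T \<in> \<T>" for T
    proof
      assume sub: "T \<subseteq> \<Union>\<C>"
      have "compactin X T" using assms T closedin_compact_space by blast
      then obtain \<F> where \<F>: "finite \<F>" "\<F> \<subseteq> \<C>" "T \<subseteq> \<Union>\<F>"
        using sub op by (meson compactinD)
      then have "\<F> \<noteq> {}" using assms(2)[OF T] by auto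
      moreover have "subset.chain A \<F>"
        using \<F>(2) \<C>(2) unfolding subset_chain_def by (meson subsetD subset_trans)
      ultimately have "\<Union>\<F> \<in> \<F>" using \<F>(1) by (simp add: Union_in_chain)
      then show False using \<F> T \<C>(2) by (auto simp: A_def subset_chain_def)
    qed
    then show ?thesis using op by (auto simp: A_def)
  qed
  ultimately obtain U where U: "U \<in> A" "\<And>V. V \<in> A \<Longrightarrow> U \<subseteq> V \<Longrightarrow> V = U"
    using subset_Zorn_nonempty[of A] by (metis empty_iff)
  show ?thesis
  proof (intro exI conjI allI impI)
    show "openin X U" "\<forall>T\<in>\<T>. \<not> T \<subseteq> U" using U(1) by (auto simp: A_def)
    fix W assume W: "openin X W \<and> \<not> W \<subseteq> U"
    then have "U \<union> W \<notin> A" using U(2)[of "U \<union> W"] by blast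
    then show "\<exists>T\<in>\<T>. T \<subseteq> U \<union> W" using W U(1) by (auto simp: A_def)
  qed
qed

text \<open>A well-founded relation is acyclic, so on a finite set its converse is well-founded too.
  This provides the last index of a finite choice.\<close>

lemma finite_maximal_wf:
  assumes "wf R" "finite S" "S \<noteq> {}"
  obtains m where "m \<in> S" "\<And>y. y \<in> S \<Longrightarrow> (m, y) \<notin> R"
proof -
  have "finite (R \<inter> S \<times> S)" using assms(2) by simp
  moreover have "acyclic (R \<inter> S \<times> S)"
    using wf_acyclic[OF assms(1)] by (rule acyclic_subset) auto
  ultimately have wf: "wf ((R \<inter> S \<times> S)\<inverse>)" by (rule finite_acyclic_wf_converse)
  obtain x where "x \<in> S" using assms(3) by blast
  then obtain z where "z \<in> S" "\<And>y. (y, z) \<in> (R \<inter> S \<times> S)\<inverse> \<Longrightarrow> y \<notin> S"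
    by (rule wfE_min[OF wf]) blast
  then show thesis using that[of z] by blast
qed

text \<open>Recursion on \<open>K\<close>: fewer than \<open>|K|\<close> nonempty open sets never form a local \<open>\<pi>\<close>-base, so every point
  has a neighbourhood whose closure contains none of the finite intersections built so far, and
  finitely many such neighbourhoods cover the space.\<close>

lemma independent_covers:
  fixes X :: "'a topology" and K :: "'i set"
  assumes X: "compact_space X" "regular_space X" "topspace X \<noteq> {}"
    and K: "uncountable K"
    and pi: "\<forall>x\<in>topspace X. \<forall>P. local_pi_base X x P \<longrightarrow> K \<lesssim> P"
  obtains h :: "'i \<Rightarrow> 'a set set" where
    "\<And>i N. i \<in> K \<Longrightarrow> N \<in> h i \<Longrightarrow> openin X N"
    "\<And>i. i \<in> K \<Longrightarrow> topspace X \<subseteq> \<Union>(h i)"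
    "\<And>G. finite G \<Longrightarrow> G \<subseteq> Sigma K h \<Longrightarrow> inj_on fst G \<Longrightarrow> topspace X - \<Union>(snd ` G) \<noteq> {}"
proof -
  obtain R where R: "wf R" "total_on K R" "R \<subseteq> K \<times> K"
    "\<And>i. i \<in> K \<Longrightarrow> {j. (j, i) \<in> R} \<prec> K"
    using initial_strict_wellorder[of K] by metis
  \<comment> \<open>Removing closures instead of the sets themselves keeps the cells of finite
    choices open, so that they can be candidates for a local \<pi>-base.\<close>
  define cell :: "('i \<times> 'a set) set \<Rightarrow> 'a set"
    where "cell G = topspace X - (\<Union>q\<in>G. X closure_of (snd q))" for G
  have cell_insert: "cell (insert q G) = cell G - X closure_of (snd q)" for q G
    by (auto simp: cell_def)
  \<comment> \<open>Injectivity of \<open>fst\<close> says that at most one member is taken from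
    each cover.\<close>
  define adm where "adm D h G \<longleftrightarrow> finite G \<and> G \<subseteq> Sigma D h \<and> inj_on fst G"
    for D and h :: "'i \<Rightarrow> 'a set set" and G
  \<comment> \<open>The recursion builds the \<open>i\<close>-th cover so that no cell of a choice
    from earlier covers is swallowed by the closure of one new member. Finiteness of the cover keeps
    the number of later choices small; the guard \<open>i \<in> K\<close> lets the recursion run
    over the whole type.\<close>
  define Q where "Q h i \<N> \<longleftrightarrow> (i \<in> K \<longrightarrow> finite \<N> \<and> (\<forall>N\<in>\<N>. openin X N) \<and> topspace X \<subseteq> \<Union>\<N> \<and>
     (\<forall>G. adm {j. (j, i) \<in> R} h G \<longrightarrow> (\<forall>N\<in>\<N>. \<not> cell G \<subseteq> X closure_of N)))" for h i \<N>
  \<comment> \<open>Split off the member with the latest index: the rest is a choice from earlier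
    covers, whose cell is not contained in the closure of that member.\<close>
  have nonempty: "cell G \<noteq> {}" if Q: "\<And>j. j \<in> D \<Longrightarrow> Q h j (h j)" and D: "D \<subseteq> K" and G: "adm D h G"
    for D h G
  proof (cases "G = {}")
    case True
    then show ?thesis using X(3) by (simp add: cell_def)
  next
    case False
    have fin: "finite (fst ` G)" "fst ` G \<noteq> {}" using G False by (auto simp: adm_def)
    obtain m where m: "m \<in> fst ` G" "\<And>y. y \<in> fst ` G \<Longrightarrow> (m, y) \<notin> R"
      using finite_maximal_wf[OF R(1) fin] by metis
    then obtain N where N: "(m, N) \<in> G" by auto
    then have mD: "m \<in> D" "N \<in> h m" using G by (auto simp: adm_def)
    have "(fst q, m) \<in> R" if "q \<in> G - {(m, N)}" for q
    proof -
      have "fst q \<noteq> m" using that N G by (auto simp: adm_def inj_on_def)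
      moreover have "q \<in> Sigma D h" using that G by (auto simp: adm_def)
      then have "fst q \<in> K" "m \<in> K" using D mD by auto
      moreover have "(m, fst q) \<notin> R" using m(2) that by blast
      ultimately show ?thesis using R(2) by (auto simp: total_on_def)
    qed
    then have "adm {j. (j, m) \<in> R} h (G - {(m, N)})"
      using G unfolding adm_def by (fastforce intro: inj_on_subset)
    then have "\<not> cell (G - {(m, N)}) \<subseteq> X closure_of N"
      using Q[OF mD(1)] mD D unfolding Q_def by blast
    moreover have "cell G = cell (G - {(m, N)}) - X closure_of N"
      using cell_insert[of "(m, N)" "G - {(m, N)}"] N by (simp add: insert_absorb)
    ultimately show ?thesis by blast
  qed
  have "\<exists>h. \<forall>i. Q h i (h i)"
  proof (rule dependent_wf_choice[OF R(1)])
    fix h g :: "'i \<Rightarrow> 'a set set" and i \<N>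
    assume "\<And>z. (z, i) \<in> R \<Longrightarrow> h z = g z"
    then have "Sigma {j. (j, i) \<in> R} h = Sigma {j. (j, i) \<in> R} g" by auto
    then show "Q h i \<N> = Q g i \<N>" by (simp add: Q_def adm_def)
  next
    fix i h assume IH: "\<And>j. (j, i) \<in> R \<Longrightarrow> Q h j (h j)"
    show "\<exists>\<N>. Q h i \<N>"
    proof (cases "i \<in> K")
      case True
      define D where "D = {j. (j, i) \<in> R}"
      define \<S> where "\<S> = cell ` Collect (adm D h)"
      have DK: "D \<subseteq> K" using R(3) by (auto simp: D_def)
      have fin: "finite (h j)" if "j \<in> D" for j
        using IH that DK by (auto simp: D_def Q_def)
      have \<S>: "openin X S" "S \<noteq> {}" if "S \<in> \<S>" for S
      proof -
        obtain G where G: "adm D h G" "S = cell G" using \<open>S \<in> \<S>\<close> by (auto simp: \<S>_def)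
        then have "finite G" by (simp add: adm_def)
        then show "openin X S"
          unfolding G(2) cell_def by (intro openin_diff closedin_Union) auto
        show "S \<noteq> {}" using nonempty[of D h G] IH DK G by (auto simp: D_def)
      qed
      \<comment> \<open>Counting the choices made before stage \<open>i\<close>: fewer than
        \<open>|K|\<close> indices, with a finite cover at each.\<close>
      have "Sigma D h \<lesssim> D \<times> (UNIV :: nat set)"
        using fin by (intro Sigma_lepoll_mono) (auto intro: finite_lepoll_infinite)
      then have "Fpow (Sigma D h) \<prec> K"
        using Fpow_Times_nat_lesspoll[OF K R(4)[OF True]]
        by (auto simp: D_def intro: lesspoll_trans1 Fpow_lepoll_mono)
      moreover have "\<S> \<lesssim> Fpow (Sigma D h)"
        unfolding \<S>_def by (rule subset_image_lepoll[of _ cell]) (auto simp: adm_def Fpow_def)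
      ultimately have small: "\<not> K \<lesssim> \<S>"
        using not_lepoll_iff_lesspoll lesspoll_trans1 by blast
      have "\<exists>V. openin X V \<and> x \<in> V \<and> (\<forall>S\<in>\<S>. \<not> S \<subseteq> X closure_of V)" if x: "x \<in> topspace X" for x
      proof -
        have "\<not> local_pi_base X x \<S>" using pi x small by blast
        then obtain W where W: "openin X W" "x \<in> W" "\<And>S. S \<in> \<S> \<Longrightarrow> \<not> S \<subseteq> W"
          using \<S> by (auto simp: local_pi_base_def)
        \<comment> \<open>Regularity shrinks \<open>W\<close> to a neighbourhood whose closure stays
          inside \<open>W\<close>.\<close>
        have "closedin X (topspace X - W)" "x \<in> topspace X - (topspace X - W)"
          using W x by auto
        then obtain V where "openin X V" "x \<in> V" "disjnt (topspace X - W) (X closure_of V)"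
          using X(2) unfolding regular_space by metis
        moreover from this have "X closure_of V \<subseteq> W"
          using closure_of_subset_topspace[of X V] by (auto simp: disjnt_iff)
        ultimately show ?thesis using W(3) by (meson subset_trans)
      qed
      then have "\<exists>V. \<forall>x\<in>topspace X. openin X (V x) \<and> x \<in> V x \<and> (\<forall>S\<in>\<S>. \<not> S \<subseteq> X closure_of (V x))"
        by (intro bchoice ballI)
      then obtain V where V: "\<And>x. x \<in> topspace X \<Longrightarrow> openin X (V x)"
        "\<And>x. x \<in> topspace X \<Longrightarrow> x \<in> V x"
        "\<And>x S. x \<in> topspace X \<Longrightarrow> S \<in> \<S> \<Longrightarrow> \<not> S \<subseteq> X closure_of (V x)"
        by blast
      have "compactin X (topspace X)" using X(1) by (simp add: compact_space_def)
      then obtain \<N> where "finite \<N>" "\<N> \<subseteq> V ` topspace X" "topspace X \<subseteq> \<Union>\<N>"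
        using compactinD[of X "topspace X" "V ` topspace X"] V(1,2) by blast
      then have "Q h i \<N>"
        using V unfolding Q_def D_def[symmetric] \<S>_def by blast
      then show ?thesis ..
    qed (simp add: Q_def)
  qed
  then obtain h where h: "\<And>i. Q h i (h i)" by blast
  show thesis
  proof
    show "openin X N" if "i \<in> K" "N \<in> h i" for i N using h[of i] that by (auto simp: Q_def)
    show "topspace X \<subseteq> \<Union>(h i)" if "i \<in> K" for i using h[of i] that by (auto simp: Q_def)
    fix G assume G: "finite G" "G \<subseteq> Sigma K h" "inj_on fst G"
    then have "cell G \<noteq> {}" using nonempty[of K h G] h by (simp add: adm_def)
    moreover have "snd q \<subseteq> X closure_of (snd q)" if "q \<in> G" for q
      using that G(2) h by (intro closure_of_subset openin_subset) (auto simp: Q_def)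
    ultimately show "topspace X - \<Union>(snd ` G) \<noteq> {}" unfolding cell_def by blast
  qed
qed

text \<open>The complement of a maximal open set covering none of the finite intersections behaves like the
  domain of an irreducible map onto a product, hence each of its points will do.\<close>

lemma independent_neighbourhoods:
  fixes X :: "'a topology" and K :: "'i set"
  assumes X: "compact_space X" "regular_space X" "topspace X \<noteq> {}"
    and K: "uncountable K"
    and pi: "\<forall>x\<in>topspace X. \<forall>P. local_pi_base X x P \<longrightarrow> K \<lesssim> P"
  obtains p and N :: "'i \<Rightarrow> 'a set" where "p \<in> topspace X"
    "\<And>i. i \<in> K \<Longrightarrow> openin X (N i) \<and> p \<in> N i"
    "\<And>W. openin X W \<Longrightarrow> p \<in> W \<Longrightarrow> finite {i \<in> K. W \<subseteq> N i}"
proof -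
  obtain h :: "'i \<Rightarrow> 'a set set" where
    h1: "\<And>i N. i \<in> K \<Longrightarrow> N \<in> h i \<Longrightarrow> openin X N" and
    h2: "\<And>i. i \<in> K \<Longrightarrow> topspace X \<subseteq> \<Union>(h i)" and
    h3: "\<And>G. finite G \<Longrightarrow> G \<subseteq> Sigma K h \<Longrightarrow> inj_on fst G \<Longrightarrow> topspace X - \<Union>(snd ` G) \<noteq> {}"
    by (rule independent_covers[OF X K pi]) blast
  \<comment> \<open>\<open>Z G\<close> is the part of the space that the choice \<open>G\<close>
    leaves uncovered. It is closed, and nonempty by independence.\<close>
  define \<G> where "\<G> = {G. finite G \<and> G \<subseteq> Sigma K h \<and> inj_on fst G}"
  define Z where "Z G = topspace X - \<Union>(snd ` G)" for G :: "('i \<times> 'a set) set"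
  have "closedin X T \<and> T \<noteq> {}" if T: "T \<in> Z ` \<G>" for T
  proof -
    obtain G where G: "finite G" "G \<subseteq> Sigma K h" "inj_on fst G" "T = Z G"
      using T by (auto simp: \<G>_def)
    have "openin X (\<Union>(snd ` G))"
      using G(2) h1 by (intro openin_Union) auto
    then show ?thesis using G h3 by (simp add: Z_def closedin_diff)
  qed
  from maximal_open_not_covering[OF X(1) this]
  obtain U where "openin X U \<and> (\<forall>T\<in>Z ` \<G>. \<not> T \<subseteq> U) \<and>
    (\<forall>W. openin X W \<and> \<not> W \<subseteq> U \<longrightarrow> (\<exists>T\<in>Z ` \<G>. T \<subseteq> U \<union> W))"
    by (rule exE)
  then have U: "\<And>G. G \<in> \<G> \<Longrightarrow> \<not> Z G \<subseteq> U"
    and U': "\<And>W. openin X W \<Longrightarrow> \<not> W \<subseteq> U \<Longrightarrow> \<exists>G\<in>\<G>. Z G \<subseteq> U \<union> W"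
    by simp_all
  \<comment> \<open>The empty choice leaves the whole space uncovered, so \<open>U\<close> is not
    the whole space.\<close>
  have "{} \<in> \<G>" by (simp add: \<G>_def)
  then obtain p where p: "p \<in> topspace X" "p \<notin> U" using U[of "{}"] by (auto simp: Z_def)
  have "\<forall>i\<in>K. \<exists>M. M \<in> h i \<and> p \<in> M" using h2 p(1) by blast
  from bchoice[OF this] obtain N where N: "\<And>i. i \<in> K \<Longrightarrow> N i \<in> h i \<and> p \<in> N i" by blast
  show thesis
  proof
    show "p \<in> topspace X" by (rule p)
    show "openin X (N i) \<and> p \<in> N i" if "i \<in> K" for i using N h1 that by blast
    fix W assume "openin X W" "p \<in> W"
    then obtain G where G: "G \<in> \<G>" "Z G \<subseteq> U \<union> W" using U'[of W] p by blast
    have "{i \<in> K. W \<subseteq> N i} \<subseteq> fst ` G"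
    proof (rule ccontr)
      assume "\<not> ?thesis"
      then obtain i where i: "i \<in> K" "W \<subseteq> N i" "i \<notin> fst ` G" by blast
      then have "insert (i, N i) G \<in> \<G>" using G(1) N by (auto simp: \<G>_def)
      then have "\<not> Z (insert (i, N i) G) \<subseteq> U" by (rule U)
      moreover have "Z (insert (i, N i) G) = Z G - N i" by (auto simp: Z_def)
      ultimately show False using G(2) i(2) by blast
    qed
    then show "finite {i \<in> K. W \<subseteq> N i}"
      using G(1) by (auto simp: \<G>_def intro: finite_subset)
  qed
qed

text \<open>Intersecting the base members with the \<open>N i\<close> keeps a local base, and
  \<open>V i\<close> can contain a neighbourhood only if \<open>N i\<close> does, which happens for
  finitely many \<open>i\<close>. Hence any infinite \<open>L\<close> will do.\<close>

lemma op_like_local_base_of_independent: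
  fixes K :: "'i set"
  assumes B: "local_base X p B" "B \<lesssim> K"
    and N: "\<And>i. i \<in> K \<Longrightarrow> openin X (N i) \<and> p \<in> N i"
      "\<And>W. openin X W \<Longrightarrow> p \<in> W \<Longrightarrow> finite {i \<in> K. W \<subseteq> N i}"
    and L: "infinite L"
  shows "\<exists>B'. local_base X p B' \<and> op_like L B'"
proof -
  have p: "p \<in> topspace X" "B \<noteq> {}" using B(1) openin_topspace by (auto simp: local_base_def)
  then obtain e where e: "e ` K = B" using B(2) inj_on_iff_surj[of B K] by (auto simp: lepoll_def)
  define V where "V i = e i \<inter> N i" for i
  have V: "openin X (V i) \<and> p \<in> V i" if "i \<in> K" for i
    using that N(1) B(1) e by (auto simp: V_def local_base_def)
  have "local_base X p (V ` K)"
    unfolding local_base_def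
  proof (intro conjI allI impI)
    fix W assume "openin X W \<and> p \<in> W"
    then obtain i where "i \<in> K" "e i \<subseteq> W" using B(1) e by (auto simp: local_base_def)
    then show "\<exists>U\<in>V ` K. U \<subseteq> W" by (auto simp: V_def)
  next
    show "p \<in> topspace X" by (rule p(1))
    show "\<forall>U\<in>V ` K. openin X U \<and> p \<in> U" using V by blast
  qed
  moreover have "op_like L (V ` K)"
    unfolding op_like_def
  proof (intro ballI notI)
    fix U assume "U \<in> V ` K" and LU: "L \<lesssim> {U' \<in> V ` K. U \<subseteq> U'}"
    then have "finite {i \<in> K. U \<subseteq> N i}" using N(2) V by blast
    moreover have "{U' \<in> V ` K. U \<subseteq> U'} \<subseteq> V ` {i \<in> K. U \<subseteq> N i}" by (auto simp: V_def)
    ultimately have "finite {U' \<in> V ` K. U \<subseteq> U'}" by (meson finite_imageI finite_subset)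
    then show False
      using lepoll_trans[OF L[unfolded infinite_le_lepoll] LU] by (simp flip: infinite_le_lepoll)
  qed
  ultimately show ?thesis by blast
qed

section \<open>Cardinality of homogeneous compacta\<close>

text \<open>By compactness, isolating \<open>x\<close> by zero sets already gives a base at
  \<open>x\<close>: outside a neighbourhood \<open>W\<close> finitely many of the functions are
  jointly bounded away from zero.\<close>

lemma local_base_of_common_zero:
  fixes f :: "'i \<Rightarrow> 'a \<Rightarrow> real"
  assumes X: "compact_space X" "x \<in> topspace X"
    and f: "\<And>i. i \<in> I \<Longrightarrow> continuous_map X euclideanreal (f i)" "\<And>i. i \<in> I \<Longrightarrow> f i x = 0"
    and uniq: "\<And>y. y \<in> topspace X \<Longrightarrow> \<forall>i\<in>I. f i y = 0 \<Longrightarrow> y = x"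
  shows "local_base X x ((\<lambda>G. {y \<in> topspace X. \<forall>q\<in>G. \<bar>f (fst q) y\<bar> < inverse (real (Suc (snd q)))})
    ` Fpow (I \<times> UNIV))"
    (is "local_base X x ( ?U ` _)")
  unfolding local_base_def
proof (intro conjI allI impI ballI)
  show "x \<in> topspace X" by fact
next
  fix V assume "V \<in> ?U ` Fpow (I \<times> UNIV)"
  then obtain G where G: "finite G" "G \<subseteq> I \<times> UNIV" "V = ?U G" by (auto simp: Fpow_def)
  from G(1,2) have "openin X ( ?U G)"
  proof (induction G)
    case (insert q G)
    have "openin X {y \<in> topspace X. f (fst q) y \<in> {- inverse (real (Suc (snd q)))<..<inverse (real (Suc (snd q)))}}"
      using insert.prems by (intro openin_continuous_map_preimage[OF f(1)]) auto
    moreover have "?U (insert q G) = ?U G \<inter>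
        {y \<in> topspace X. f (fst q) y \<in> {- inverse (real (Suc (snd q)))<..<inverse (real (Suc (snd q)))}}"
      by (auto simp: abs_less_iff)
    ultimately show ?case using insert by (simp add: openin_Int)
  qed simp
  then show "openin X V" by (simp add: G)
  have "f (fst q) x = 0" if "q \<in> G" for q using that G(2) f(2) by auto
  then show "x \<in> V" using X(2) G(3) by simp
next
  fix W assume W: "openin X W \<and> x \<in> W"
  define O' where "O' q = {y \<in> topspace X. f (fst q) y \<in> {r. inverse (real (Suc (snd q))) < \<bar>r\<bar>}}" for q
  have "compactin X (topspace X - W)"
    using W X(1) by (simp add: closedin_compact_space closedin_diff)
  moreover have "openin X T" if T: "T \<in> O' ` (I \<times> UNIV)" for T
  proof -
    obtain i n where i: "i \<in> I" "T = O' (i, n)" using T by auto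
    have "open {r::real. inverse (real (Suc n)) < \<bar>r\<bar>}"
      by (intro open_Collect_less continuous_intros)
    then show ?thesis
      unfolding i(2) O'_def by (intro openin_continuous_map_preimage[of X euclideanreal]) (simp_all add: f(1) i(1))
  qed
  moreover have "topspace X - W \<subseteq> \<Union> (O' ` (I \<times> UNIV))"
  proof
    fix y assume y: "y \<in> topspace X - W"
    then have "y \<noteq> x" using W by auto
    then obtain i where i: "i \<in> I" "f i y \<noteq> 0" using uniq y by blast
    then obtain n where "inverse (real (Suc n)) < \<bar>f i y\<bar>"
      using reals_Archimedean[of "\<bar>f i y\<bar>"] by auto
    then have "y \<in> O' (i, n)" using y by (simp add: O'_def)
    then show "y \<in> \<Union> (O' ` (I \<times> UNIV))" using i(1) by blast
  qed
  ultimately obtain \<F> where \<F>: "finite \<F>" "\<F> \<subseteq> O' ` (I \<times> UNIV)" "topspace X - W \<subseteq> \<Union>\<F>"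
    by (meson compactinD)
  then obtain G where G: "finite G" "G \<subseteq> I \<times> UNIV" "\<F> = O' ` G"
    using finite_subset_image[of \<F> O' "I \<times> UNIV"] by auto
  have "?U G \<subseteq> W"
  proof
    fix y assume y: "y \<in> ?U G"
    show "y \<in> W"
    proof (rule ccontr)
      assume "y \<notin> W"
      then obtain q where "q \<in> G" "y \<in> O' q" using y \<F>(3) G(3) by auto
      then show False using y by (auto simp: O'_def)
    qed
  qed
  moreover have "?U G \<in> ?U ` Fpow (I \<times> UNIV)" using G by (intro imageI) (simp add: Fpow_def)
  ultimately show "\<exists>U\<in>?U ` Fpow (I \<times> UNIV). U \<subseteq> W" by (rule bexI)
qed

text \<open>A diagonal form of the Cech--Pospisil theorem: if the space were enumerated by \<open>K\<close>, one could
  exclude its points one at a time by a decreasing sequence of nonempty intersections of zero sets.\<close>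

lemma not_topspace_lepoll_character:
  fixes X :: "'a topology" and K :: "'i set"
  assumes X: "compact_space X" "Hausdorff_space X" "topspace X \<noteq> {}"
    and K: "uncountable K"
    and char: "\<forall>x\<in>topspace X. \<forall>B. local_base X x B \<longrightarrow> K \<lesssim> B"
  shows "\<not> topspace X \<lesssim> K"
proof
  assume "topspace X \<lesssim> K"
  then obtain e where e: "e ` K = topspace X"
    using inj_on_iff_surj[of "topspace X" K] X(3) by (auto simp: lepoll_def)
  obtain R where R: "wf R" "total_on K R" "R \<subseteq> K \<times> K"
    "\<And>i. i \<in> K \<Longrightarrow> {j. (j, i) \<in> R} \<prec> K"
    using initial_strict_wellorder[of K] by metis
  \<comment> \<open>Stage \<open>i\<close> excludes the point \<open>e i\<close> by a function that
    does not vanish there but still has a common zero with all earlier ones.\<close>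
  define Q where "Q f i g \<longleftrightarrow> (i \<in> K \<longrightarrow> continuous_map X euclideanreal g \<and> g (e i) \<noteq> 0 \<and>
     (\<exists>y\<in>topspace X. g y = 0 \<and> (\<forall>j. (j, i) \<in> R \<longrightarrow> f j y = 0)))"
    for f :: "'i \<Rightarrow> 'a \<Rightarrow> real" and i and g :: "'a \<Rightarrow> real"
  \<comment> \<open>For finitely many indices, the common zero recorded at the latest one works for
    all of them; compactness then passes to arbitrary \<open>D\<close>.\<close>
  have zero: "\<exists>y\<in>topspace X. \<forall>j\<in>D. f j y = 0"
    if Q: "\<And>j. j \<in> D \<Longrightarrow> Q f j (f j)" and D: "D \<subseteq> K" for D f
  proof -
    have fin: "\<exists>y\<in>topspace X. \<forall>j\<in>S. f j y = 0" if S: "finite S" "S \<subseteq> D" for S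
    proof (cases "S = {}")
      case True
      then show ?thesis using X(3) by blast
    next
      case False
      obtain m where m: "m \<in> S" "\<And>y. y \<in> S \<Longrightarrow> (m, y) \<notin> R"
        using finite_maximal_wf[OF R(1) S(1) False] by metis
      then obtain y where y: "y \<in> topspace X" "f m y = 0" "\<And>j. (j, m) \<in> R \<Longrightarrow> f j y = 0"
        using Q[of m] S D unfolding Q_def by blast
      have "f j y = 0" if "j \<in> S" for j
      proof (cases "j = m")
        case False
        then have "(j, m) \<in> R"
          using R(2) m that S D unfolding total_on_def by blast
        then show ?thesis by (rule y(3))
      qed (simp add: y)
      then show ?thesis using y(1) by blast
    qed
    define Z where "Z j = {y \<in> topspace X. f j y \<in> {0}}" for j
    have cl: "closedin X (Z j)" if "j \<in> D" for j
      unfolding Z_def using Q[OF that] that D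
      by (intro closedin_continuous_map_preimage[of X euclideanreal]) (auto simp: Q_def)
    \<comment> \<open>Inserting \<open>topspace X\<close> keeps the intersection inside the space
      when \<open>D\<close> is empty.\<close>
    have "\<Inter> (insert (topspace X) (Z ` D)) \<noteq> {}"
    proof (rule X(1)[unfolded compact_space_fip, rule_format], intro conjI ballI allI impI)
      show "closedin X C" if "C \<in> insert (topspace X) (Z ` D)" for C
        using that cl by auto
      fix \<F> assume \<F>: "finite \<F> \<and> \<F> \<subseteq> insert (topspace X) (Z ` D)"
      then have "finite (\<F> - {topspace X})" "\<F> - {topspace X} \<subseteq> Z ` D" by auto
      then obtain S where S: "S \<subseteq> D" "finite S" "\<F> - {topspace X} = Z ` S"
        using finite_subset_image[of "\<F> - {topspace X}" Z D] by auto
      then obtain y where y: "y \<in> topspace X" "\<forall>j\<in>S. f j y = 0" using fin[OF S(2,1)] by blast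
      have "y \<in> C" if "C \<in> \<F>" for C
      proof (cases "C = topspace X")
        case False
        then have "C \<in> Z ` S" using that S(3) by blast
        then show ?thesis using y by (auto simp: Z_def)
      qed (simp add: y)
      then show "\<Inter>\<F> \<noteq> {}" by blast
    qed
    then show ?thesis by (auto simp: Z_def)
  qed
  have "\<exists>f. \<forall>i. Q f i (f i)"
  proof (rule dependent_wf_choice[OF R(1)])
    fix f g :: "'i \<Rightarrow> 'a \<Rightarrow> real" and i r
    assume "\<And>z. (z, i) \<in> R \<Longrightarrow> f z = g z"
    then show "Q f i r = Q g i r" by (simp add: Q_def)
  next
    fix i f assume IH: "\<And>j. (j, i) \<in> R \<Longrightarrow> Q f j (f j)"
    show "\<exists>g. Q f i g"
    proof (cases "i \<in> K")
      case True
      define D where "D = {j. (j, i) \<in> R}"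
      have DK: "D \<subseteq> K" using R(3) by (auto simp: D_def)
      have QD: "Q f j (f j)" if "j \<in> D" for j using IH that by (simp add: D_def)
      have ei: "e i \<in> topspace X" using e True by blast
      \<comment> \<open>Otherwise \<open>e i\<close> is the only common zero of fewer than
        \<open>|K|\<close> functions and has a local base smaller than \<open>K\<close>.\<close>
      have "\<exists>y\<in>topspace X. (\<forall>j\<in>D. f j y = 0) \<and> y \<noteq> e i"
      proof (rule ccontr)
        assume "\<not> ?thesis"
        then have uniq: "y = e i" if "y \<in> topspace X" "\<forall>j\<in>D. f j y = 0" for y
          using that by blast
        obtain y where "y \<in> topspace X" "\<forall>j\<in>D. f j y = 0" using zero[OF QD DK] by blast
        then have z: "\<forall>j\<in>D. f j (e i) = 0" using uniq by blast
        let ?\<B> = "(\<lambda>G. {y \<in> topspace X. \<forall>q\<in>G. \<bar>f (fst q) y\<bar> < inverse (real (Suc (snd q)))})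
          ` Fpow (D \<times> (UNIV :: nat set))"
        have "local_base X (e i) ?\<B>"
        proof (rule local_base_of_common_zero[OF X(1) ei])
          show "continuous_map X euclideanreal (f j)" if "j \<in> D" for j
            using QD[OF that] that DK by (auto simp: Q_def)
        qed (use z uniq in auto)
        then have "K \<lesssim> ?\<B>" using char ei by blast
        then have "K \<lesssim> Fpow (D \<times> (UNIV :: nat set))" using image_lepoll by (rule lepoll_trans)
        moreover have "Fpow (D \<times> (UNIV :: nat set)) \<prec> K"
          using Fpow_Times_nat_lesspoll[OF K R(4)[OF True]] by (simp add: D_def)
        ultimately show False using not_lepoll_iff_lesspoll by blast
      qed
      then obtain y where y: "y \<in> topspace X" "\<forall>j\<in>D. f j y = 0" "y \<noteq> e i" by blast
      \<comment> \<open>Urysohn's lemma supplies the new function: zero at \<open>y\<close>, one at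
        \<open>e i\<close>.\<close>
      have "normal_space X"
        using X compact_Hausdorff_or_regular_imp_normal_space by blast
      moreover have "closedin X {y}" "closedin X {e i}"
        using X(2) y ei by (simp_all add: closedin_Hausdorff_sing_eq)
      moreover have "disjnt {y} {e i}" using y by simp
      ultimately obtain g where g: "continuous_map X euclideanreal g" "g ` {y} \<subseteq> {0}" "g ` {e i} \<subseteq> {1}"
        by (rule Urysohn_lemma_alt)
      then have "Q f i g" using y by (auto simp: Q_def D_def)
      then show ?thesis by (rule exI[of "Q f i"])
    qed (simp add: Q_def)
  qed
  then obtain f where f: "\<And>i. Q f i (f i)" by blast
  obtain y where y: "y \<in> topspace X" "\<forall>j\<in>K. f j y = 0" using zero[OF f subset_refl] by blast
  then obtain i where "i \<in> K" "y = e i" using e by blast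
  then show False using y(2) f[of i] by (simp add: Q_def)
qed

section \<open>Density and the number of points\<close>

text \<open>Closing off through the successor cardinal of \<open>M\<close>. Each stage stays within
  \<open>Pow M\<close> because a set of that size has no more subsets of size at most
  \<open>M\<close>, and the successor has at most \<open>|Pow M|\<close> stages. By its regularity a
  small family already appears at one stage.\<close>

lemma closed_under_small_families:
  fixes B :: "'a \<Rightarrow> 'b set" and M :: "'m set" and pt :: "'b set \<Rightarrow> 'a"
  assumes M: "infinite M" and B: "\<And>x. x \<in> T \<Longrightarrow> B x \<lesssim> M"
    and pt: "\<And>W. good W \<Longrightarrow> pt W \<in> T"
  shows "\<exists>D\<subseteq>T. D \<lesssim> Pow M \<and> (\<forall>W. W \<subseteq> (\<Union>x\<in>D. B x) \<and> W \<lesssim> M \<and> good W \<longrightarrow> pt W \<in> D)"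
proof -
  define cl where "cl S = S \<union> pt ` {W. W \<subseteq> (\<Union>x\<in>S. B x) \<and> W \<lesssim> M \<and> good W}" for S
  have infP: "infinite (Pow M)" using M by simp
  have MP: "M \<lesssim> Pow M" by (rule lepoll_Pow_self)
  have cl_T: "cl S \<subseteq> T" if "S \<subseteq> T" for S using that pt by (auto simp: cl_def)
  have cl_bound: "cl S \<lesssim> Pow M" if S: "S \<subseteq> T" "S \<lesssim> Pow M" for S
  proof -
    have "(\<Union>x\<in>S. B x) \<lesssim> Pow M"
    proof (rule UN_lepoll[OF infP S(2)])
      fix x assume "x \<in> S"
      then have "B x \<lesssim> M" using B S(1) by blast
      then show "B x \<lesssim> Pow M" using MP by (rule lepoll_trans)
    qed
    then have small: "{W. W \<subseteq> (\<Union>x\<in>S. B x) \<and> W \<lesssim> M} \<lesssim> Pow M"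
      by (rule small_subsets_lepoll[OF M])
    have "pt ` {W. W \<subseteq> (\<Union>x\<in>S. B x) \<and> W \<lesssim> M \<and> good W} \<subseteq> pt ` {W. W \<subseteq> (\<Union>x\<in>S. B x) \<and> W \<lesssim> M}"
      by blast
    from lepoll_trans[OF subset_image_lepoll[OF this] small]
    have "(\<Union>b\<in>UNIV. if b then S else pt ` {W. W \<subseteq> (\<Union>x\<in>S. B x) \<and> W \<lesssim> M \<and> good W}) \<lesssim> Pow M"
      using infP S(2) by (intro UN_lepoll) (auto intro: finite_lepoll_infinite)
    then show ?thesis by (simp add: cl_def UNIV_bool Un_commute)
  qed
  define r where "r = cardSuc |M|"
  have r: "Card_order r" unfolding r_def by (rule cardSuc_Card_order[OF card_of_Card_order])
  then have wo: "Well_order r" by (simp add: card_order_on_def)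
  then have wf: "wf (r - Id)" by (simp add: well_order_on_def)
  have seg: "{j. (j, i) \<in> r - Id} \<lesssim> M" for i
  proof (cases "i \<in> Field r")
    case True
    then have "|underS r i| <o cardSuc |M|" using card_of_underS[OF r] by (simp add: r_def)
    then have "|underS r i| \<le>o |M|"
      using cardSuc_ordLeq_ordLess[OF card_of_Card_order card_of_Card_order] by blast
    moreover have "underS r i = {j. (j, i) \<in> r - Id}" by (auto simp: underS_def)
    ultimately show ?thesis by (simp add: lepoll_iff_card_of)
  next
    case False
    then have "{j. (j, i) \<in> r - Id} = {}" by (auto simp: Field_def)
    then show ?thesis by (simp only: empty_lepoll)
  qed
  \<comment> \<open>Stage \<open>i\<close> collects the closures of all earlier stages; one equation
    serves for zero, successor and limit stages.\<close>
  have "\<exists>A. \<forall>i. A i = (\<Union>j\<in>{j. (j, i) \<in> r - Id}. cl (A j))"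
    by (rule dependent_wf_choice[OF wf]) auto
  then obtain A where A: "\<And>i. A i = (\<Union>j\<in>{j. (j, i) \<in> r - Id}. cl (A j))" by blast
  have AT: "A i \<subseteq> T \<and> A i \<lesssim> Pow M" for i
    using wf
  proof (induction i)
    case (less i)
    have "A i \<subseteq> T" unfolding A[of i] using less cl_T by (intro UN_least) blast
    moreover have "A i \<lesssim> Pow M"
      unfolding A[of i] using less cl_bound by (intro UN_lepoll[OF infP lepoll_trans[OF seg MP]]) blast
    ultimately show ?case ..
  qed
  have step: "cl (A i) \<subseteq> A j" if "(i, j) \<in> r" "i \<noteq> j" for i j
    unfolding A[of j] using that by (intro UN_upper) simp
  have chain: "relChain r A"
    unfolding relChain_def
  proof (intro allI impI)
    fix i j assume "(i, j) \<in> r"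
    then show "A i \<subseteq> A j" using step[of i j] by (cases "i = j") (auto simp: cl_def)
  qed
  define D where "D = (\<Union>i\<in>Field r. A i)"
  have infr: "infinite (Field r)"
    unfolding r_def using cardSuc_finite[OF card_of_Card_order, of M] M by (simp add: Field_card_of)
  have "r \<le>o |Pow M|"
    unfolding r_def by (rule cardSuc_least) (simp_all add: card_of_Card_order card_of_Pow)
  then have "|Field r| \<le>o |Pow M|"
    using card_of_Field_ordIso[OF r] ordIso_ordLeq_trans by blast
  then have "D \<lesssim> Pow M"
    unfolding D_def using AT by (intro UN_lepoll[OF infP]) (simp_all add: lepoll_iff_card_of)
  moreover have "D \<subseteq> T" unfolding D_def using AT by blast
  moreover have "pt W \<in> D" if W: "W \<subseteq> (\<Union>x\<in>D. B x)" "W \<lesssim> M" "good W" for W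
  proof -
    \<comment> \<open>Each member of \<open>W\<close> is charged to a point of \<open>D\<close>.
      These are at most \<open>|M|\<close> points, so they all lie in one stage
      \<open>A i\<close>.\<close>
    have "\<forall>w\<in>W. \<exists>x. x \<in> D \<and> w \<in> B x" using W(1) by blast
    from bchoice[OF this] obtain q where q: "\<And>w. w \<in> W \<Longrightarrow> q w \<in> D \<and> w \<in> B (q w)" by blast
    have "q ` W \<lesssim> M" using image_lepoll W(2) by (rule lepoll_trans)
    then have "|q ` W| \<le>o |M|" by (simp add: lepoll_iff_card_of)
    moreover have "q ` W \<subseteq> (\<Union>i\<in>Field (cardSuc |M| ). A i)"
      using q by (auto simp: D_def r_def)
    ultimately obtain i where i: "i \<in> Field r" "q ` W \<subseteq> A i"
      using cardSuc_UNION[OF card_of_Card_order, of M A "q ` W"] chain M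
      by (auto simp: r_def Field_card_of)
    \<comment> \<open>An infinite cardinal has no last element, so some later stage receives
      \<open>pt W\<close>.\<close>
    obtain j where j: "j \<in> Field r" "i \<noteq> j" "(i, j) \<in> r"
      using infinite_Card_order_limit[OF r infr i(1)] by blast
    have "W \<subseteq> (\<Union>x\<in>A i. B x)" using q i(2) by blast
    then have "pt W \<in> cl (A i)" using W(2,3) by (simp add: cl_def)
    then show ?thesis using step[OF j(3,2)] j(1) unfolding D_def by blast
  qed
  ultimately show ?thesis by blast
qed

text \<open>In a maximal disjoint subfamily nothing can be added, so a nonempty member of the family
  must meet its union.\<close>

lemma maximal_disjoint_subfamily:
  "\<exists>F\<subseteq>\<W>. pairwise disjnt F \<and> (\<forall>U\<in>\<W>. U \<noteq> {} \<longrightarrow> \<not> disjnt U (\<Union>F))"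
proof -
  define A where "A = {F. F \<subseteq> \<W> \<and> pairwise disjnt F}"
  have "{} \<in> A" by (simp add: A_def)
  moreover have "\<Union>\<C> \<in> A" if \<C>: "subset.chain A \<C>" for \<C>
  proof -
    have "pairwise disjnt (\<Union>\<C>)"
      using \<C> by (intro pairwise_chain_Union) (auto simp: A_def subset_chain_def chain_subset_def)
    then show ?thesis using \<C> by (auto simp: A_def subset_chain_def)
  qed
  ultimately have "\<exists>F\<in>A. \<forall>G\<in>A. F \<subseteq> G \<longrightarrow> G = F"
    by (intro subset_Zorn_nonempty) auto
  then obtain F where F: "F \<in> A" "\<And>G. G \<in> A \<Longrightarrow> F \<subseteq> G \<Longrightarrow> G = F" by blast
  have "\<not> disjnt U (\<Union>F)" if U: "U \<in> \<W>" "U \<noteq> {}" for U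
  proof
    assume dis: "disjnt U (\<Union>F)"
    then have "insert U F \<in> A"
      using F(1) U(1) by (auto simp: A_def pairwise_insert disjnt_sym)
    then have "U \<in> F" using F(2)[of "insert U F"] by blast
    then show False using dis U(2) by (auto simp: disjnt_def)
  qed
  moreover have "F \<subseteq> \<W>" "pairwise disjnt F" using F(1) by (simp_all add: A_def)
  ultimately show ?thesis by blast
qed

text \<open>Shapirovskii's bound on the density by the local \<open>\<pi>\<close>-character and the cellularity.\<close>

lemma dense_subset_lepoll_Pow:
  fixes X :: "'a topology" and M :: "'m set"
  assumes X: "regular_space X" and M: "infinite M"
    and B: "\<forall>x\<in>topspace X. \<exists>P. local_pi_base X x P \<and> P \<lesssim> M"
    and cellular: "\<forall>F. cellular_family X F \<longrightarrow> F \<lesssim> M"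
  shows "\<exists>D\<subseteq>topspace X. D \<lesssim> Pow M \<and> (\<forall>V. openin X V \<and> V \<noteq> {} \<longrightarrow> V \<inter> D \<noteq> {})"
proof -
  from bchoice[OF B] obtain P where P: "\<And>x. x \<in> topspace X \<Longrightarrow> local_pi_base X x (P x) \<and> P x \<lesssim> M"
    by blast
  \<comment> \<open>A family is good if its union is not dense; \<open>pt\<close> then picks a point
    outside the closure of that union.\<close>
  define good where "good W \<longleftrightarrow> topspace X - X closure_of \<Union>W \<noteq> {}" for W
  define pt where "pt W = (SOME x. x \<in> topspace X - X closure_of \<Union>W)" for W
  have pt: "pt W \<in> topspace X - X closure_of \<Union>W" if "good W" for W
    unfolding pt_def using that some_in_eq unfolding good_def by blast
  have "\<exists>D\<subseteq>topspace X. D \<lesssim> Pow M \<and> (\<forall>W. W \<subseteq> (\<Union>x\<in>D. P x) \<and> W \<lesssim> M \<and> good W \<longrightarrow> pt W \<in> D)"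
    using P pt by (intro closed_under_small_families[OF M]) auto
  then obtain D where D: "D \<subseteq> topspace X" "D \<lesssim> Pow M"
    "\<And>W. W \<subseteq> (\<Union>x\<in>D. P x) \<Longrightarrow> W \<lesssim> M \<Longrightarrow> good W \<Longrightarrow> pt W \<in> D"
    by blast
  have "V \<inter> D \<noteq> {}" if V: "openin X V" "V \<noteq> {}" for V
  proof
    assume disj: "V \<inter> D = {}"
    obtain v where v: "v \<in> V" using V by blast
    then have "closedin X (topspace X - V)" "v \<in> topspace X - (topspace X - V)"
      using V openin_subset by auto
    then obtain V' where V': "openin X V'" "v \<in> V'" "disjnt (topspace X - V) (X closure_of V')"
      using X unfolding regular_space by metis
    \<comment> \<open>\<open>W\<close> is a maximal cellular family of \<pi>-base members at points
      of \<open>D\<close> that miss \<open>V'\<close>. Its size is bounded by the cellularity, and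
      \<open>V'\<close> witnesses that it is good.\<close>
    from maximal_disjoint_subfamily[of "{U \<in> (\<Union>x\<in>D. P x). disjnt U V'}"]
    obtain W where W: "W \<subseteq> {U \<in> (\<Union>x\<in>D. P x). disjnt U V'}" "pairwise disjnt W"
      "\<forall>U\<in>{U \<in> (\<Union>x\<in>D. P x). disjnt U V'}. U \<noteq> {} \<longrightarrow> \<not> disjnt U (\<Union>W)"
      by (elim exE conjE)
    have PD: "openin X U \<and> U \<noteq> {}" if "U \<in> (\<Union>x\<in>D. P x)" for U
      using that P D(1) by (auto simp: local_pi_base_def)
    have "cellular_family X W"
      unfolding cellular_family_def using W(1,2) PD by blast
    then have "W \<lesssim> M" using cellular by blast
    moreover have WD: "W \<subseteq> (\<Union>x\<in>D. P x)" using W(1) by blast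
    moreover have "good W"
    proof -
      have "V' \<inter> \<Union>W = {}" using W(1) by (auto simp: disjnt_iff)
      then have "V' \<inter> X closure_of \<Union>W = {}"
        using openin_Int_closure_of_eq_empty[OF V'(1)] by blast
      then show ?thesis using V' openin_subset[OF V'(1)] unfolding good_def by blast
    qed
    ultimately have d: "pt W \<in> D" "pt W \<in> topspace X - X closure_of \<Union>W"
      using D(3) pt by blast+
    \<comment> \<open>\<open>pt W\<close> lies in \<open>D\<close>, hence outside \<open>V\<close>
      and so outside the closure of \<open>V'\<close>. A \<pi>-base member at \<open>pt W\<close>
      inside \<open>N\<close> misses \<open>V'\<close> and \<open>\<Union>W\<close>, against
      maximality.\<close>
    define N where "N = topspace X - X closure_of \<Union>W - X closure_of V'"
    have "openin X N" unfolding N_def by (intro openin_diff) auto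
    moreover have "pt W \<notin> X closure_of V'"
      using V'(3) d disj by (auto simp: disjnt_iff)
    then have "pt W \<in> N" using d by (simp add: N_def)
    ultimately obtain U where U: "U \<in> P (pt W)" "U \<subseteq> N"
      using P[of "pt W"] d(2) by (auto simp: local_pi_base_def)
    have UD: "U \<in> (\<Union>x\<in>D. P x)" using U d by blast
    have clW: "\<Union>W \<subseteq> X closure_of \<Union>W"
      using WD PD by (intro closure_of_subset) (blast dest: openin_subset)
    have clV: "V' \<subseteq> X closure_of V'"
      by (intro closure_of_subset openin_subset V'(1))
    have "disjnt U V'" "disjnt U (\<Union>W)"
      using U(2) clV clW unfolding N_def disjnt_def by blast+
    then show False using W(3) UD PD[OF UD] by blast
  qed
  then show ?thesis using D by blast
qed

text \<open>A point of a homogeneous space is determined by the trace on a dense set of a translate of a fixed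
  local \<open>\<pi>\<close>-base.\<close>

lemma homogeneous_topspace_lepoll_Pow:
  fixes X :: "'a topology" and M :: "'m set"
  assumes X: "Hausdorff_space X" "homogeneous_space X" and M: "infinite M"
    and p: "p \<in> topspace X" "local_pi_base X p P" "P \<lesssim> M"
    and D: "D \<lesssim> Pow M" "\<And>V. openin X V \<Longrightarrow> V \<noteq> {} \<Longrightarrow> V \<inter> D \<noteq> {}"
  shows "topspace X \<lesssim> Pow M"
proof -
  have "\<forall>x\<in>topspace X. \<exists>f. homeomorphic_map X X f \<and> f p = x"
    using X(2) p(1) by (auto simp: homogeneous_space_def)
  from bchoice[OF this] obtain h where h: "\<And>x. x \<in> topspace X \<Longrightarrow> homeomorphic_map X X (h x) \<and> h x p = x"
    by blast
  define code where "code x = (\<lambda>U\<in>P. SOME d. d \<in> h x ` U \<inter> D)" for x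
  have code: "code x U \<in> h x ` U \<inter> D" if "x \<in> topspace X" "U \<in> P" for x U
  proof -
    have "openin X U" "U \<noteq> {}" using p(2) that(2) by (auto simp: local_pi_base_def)
    then have "openin X (h x ` U)" "h x ` U \<noteq> {}"
      using h[OF that(1)] by (auto intro: openin_homeomorphic_image)
    then have "h x ` U \<inter> D \<noteq> {}" by (rule D(2))
    then show ?thesis using that(2) by (simp add: code_def some_in_eq del: Int_iff)
  qed
  have "inj_on code (topspace X)"
  proof (rule inj_onI, rule ccontr)
    fix x y assume xy: "x \<in> topspace X" "y \<in> topspace X" "code x = code y" "x \<noteq> y"
    then obtain V W where VW: "openin X V" "openin X W" "x \<in> V" "y \<in> W" "disjnt V W"
      using X(1) unfolding Hausdorff_space_def by metis
    obtain V' where V': "openin X V'" "p \<in> V'" "h x ` V' \<subseteq> V"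
      using homeomorphic_map_neighbourhood[of X "h x" p V] h[OF xy(1)] p(1) VW by metis
    obtain W' where W': "openin X W'" "p \<in> W'" "h y ` W' \<subseteq> W"
      using homeomorphic_map_neighbourhood[of X "h y" p W] h[OF xy(2)] p(1) VW by metis
    \<comment> \<open>One member \<open>U\<close> is small enough for both maps, so its two
      translates lie in disjoint sets and cannot share the point \<open>code x U\<close>.\<close>
    have "openin X (V' \<inter> W')" "p \<in> V' \<inter> W'" using V' W' by auto
    then obtain U where U: "U \<in> P" "U \<subseteq> V' \<inter> W'"
      using p(2) unfolding local_pi_base_def by blast
    have "code x U \<in> h x ` U" "code x U \<in> h y ` U"
      using code[OF xy(1) U(1)] code[OF xy(2) U(1)] xy(3) by auto
    then have "code x U \<in> V" "code x U \<in> W" using U(2) V'(3) W'(3) by blast+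
    then show False using VW(5) by (auto simp: disjnt_iff)
  qed
  moreover have "code ` topspace X \<subseteq> P \<rightarrow>\<^sub>E D"
    using code by (auto simp: code_def)
  ultimately have "topspace X \<lesssim> P \<rightarrow>\<^sub>E D" by (auto simp: lepoll_def)
  also have "\<dots> \<lesssim> Pow M" by (rule Func_Pow_lepoll[OF M p(3) D(1)])
  finally show ?thesis .
qed

section \<open>GCH and comparison of cardinals in different types\<close>

text \<open>\<open>GCH_upto\<close> speaks only of subsets of \<open>Pow A\<close>, so a
  counterexample \<open>L\<close> is first copied into \<open>Pow A\<close>, where it would lie
  strictly between \<open>A\<close> and \<open>Pow A\<close>.\<close>

lemma GCH_upto_Pow_lepoll:
  fixes A :: "'b set" and L :: "'l set"
  assumes "GCH_upto TYPE('b)" "infinite A" "A \<prec> L"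
  shows "Pow A \<lesssim> L"
proof (rule ccontr)
  assume "\<not> Pow A \<lesssim> L"
  then have L: "L \<prec> Pow A" by (simp add: not_lepoll_iff_lesspoll)
  then obtain f where f: "inj_on f L" "f ` L \<subseteq> Pow A"
    using lesspoll_imp_lepoll unfolding lepoll_def by blast
  have eq: "f ` L \<approx> L" by (rule inj_on_image_eqpoll_self[OF f(1)])
  have "A \<lesssim> f ` L"
    using lesspoll_imp_lepoll[OF assms(3)] eqpoll_imp_lepoll[OF eqpoll_sym[OF eq]] by (rule lepoll_trans)
  then have "f ` L \<approx> A \<or> f ` L \<approx> Pow A"
    using assms(1,2) f(2) unfolding GCH_upto_def by blast
  then have "L \<approx> A \<or> L \<approx> Pow A"
    using eqpoll_trans[OF eqpoll_sym[OF eq], of A] eqpoll_trans[OF eqpoll_sym[OF eq], of "Pow A"]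
    by blast
  then show False
    using L assms(3) eqpoll_sym[of L A] by (auto simp: lesspoll_def)
qed

text \<open>Cardinals are well-ordered. This makes a smallest local base available as a
  representative of the character.\<close>

lemma lepoll_minimal_set:
  assumes "\<A> \<noteq> {}"
  obtains A where "A \<in> \<A>" "\<And>B. B \<in> \<A> \<Longrightarrow> A \<lesssim> B"
proof -
  have "\<exists>r\<in>card_of ` \<A>. \<forall>r'\<in>card_of ` \<A>. r \<le>o r'"
    using assms by (intro exists_minim_Card_order) (auto simp: card_of_Card_order)
  then show thesis using that by (auto simp: lepoll_iff_card_of)
qed

text \<open>\<open>is_chiNt\<close> compares \<open>K\<close> only with sets of its own type. If
  \<open>K\<close> were larger than \<open>C\<close>, then \<open>C\<close> would embed in
  \<open>K\<close>, and this copy would be a competitor of the right type.\<close>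

lemma chiNt_lepoll:
  fixes K :: "'k set" and C :: "'c set"
  assumes K: "is_chiNt X K" and C: "infinite C"
    and base: "\<And>p. p \<in> topspace X \<Longrightarrow> \<exists>B. local_base X p B \<and> op_like C B"
  shows "K \<lesssim> C"
proof (rule ccontr)
  assume "\<not> K \<lesssim> C"
  then have "C \<lesssim> K" by (simp add: not_lepoll_iff_lesspoll lesspoll_imp_lepoll)
  then obtain g where g: "inj_on g C" "g ` C \<subseteq> K" by (auto simp: lepoll_def)
  have C': "infinite (g ` C)" using g(1) C by (simp add: finite_image_iff)
  have eq: "g ` C \<approx> C" by (rule inj_on_image_eqpoll_self[OF g(1)])
  have "\<exists>L::'k set. is_chiNt_pt X p L \<and> L \<lesssim> g ` C" if p: "p \<in> topspace X" for p
  proof -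
    obtain L :: "'k set" where L: "is_chiNt_pt X p L" using K p by (auto simp: is_chiNt_def)
    obtain B where B: "local_base X p B" "op_like C B" using base[OF p] by blast
    have "op_like (g ` C) B"
      using B(2) eqpoll_imp_lepoll[OF eqpoll_sym[OF eq]] unfolding op_like_def
      by (auto dest: lepoll_trans)
    then have "L \<lesssim> g ` C" using L B(1) C' unfolding is_chiNt_pt_def by blast
    then show ?thesis using L by blast
  qed
  then have "K \<lesssim> g ` C" using K unfolding is_chiNt_def by blast
  then have "K \<lesssim> C" using eq by (rule lepoll_trans2)
  with \<open>\<not> K \<lesssim> C\<close> show False ..
qed

lemma exists_subset_eqpoll:
  assumes "S \<lesssim> L"
  obtains M where "M \<subseteq> L" "S \<approx> M"
proof -
  obtain g where g: "inj_on g S" "g ` S \<subseteq> L" using assms by (auto simp: lepoll_def)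
  show thesis
    by (rule that[OF g(2) eqpoll_sym[OF inj_on_image_eqpoll_self[OF g(1)]]])
qed

text \<open>The maximum of the cardinals of \<open>A\<close> and \<open>C\<close>, realised as a
  subset of \<open>L\<close> so that it has the type of \<open>L\<close>.\<close>

lemma exists_intermediate_set:
  fixes L :: "'l set"
  assumes "A \<prec> L" "C \<prec> L" "infinite C"
  obtains M :: "'l set" where "infinite M" "A \<lesssim> M" "C \<lesssim> M" "M \<prec> L"
proof -
  have "\<exists>M :: 'l set. A \<lesssim> M \<and> C \<lesssim> M \<and> M \<prec> L"
  proof (cases "A \<lesssim> C")
    case True
    obtain M where M: "M \<subseteq> L" "C \<approx> M"
      using exists_subset_eqpoll[OF lesspoll_imp_lepoll[OF assms(2)]] .
    then show ?thesis
      using lepoll_trans2[OF True M(2)] eqpoll_imp_lepoll[OF M(2)] eq_lesspoll_trans[OF eqpoll_sym[OF M(2)] assms(2)]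
      by blast
  next
    case False
    then have CA: "C \<lesssim> A" by (simp add: not_lepoll_iff_lesspoll lesspoll_imp_lepoll)
    obtain M where M: "M \<subseteq> L" "A \<approx> M"
      using exists_subset_eqpoll[OF lesspoll_imp_lepoll[OF assms(1)]] .
    then show ?thesis
      using lepoll_trans2[OF CA M(2)] eqpoll_imp_lepoll[OF M(2)] eq_lesspoll_trans[OF eqpoll_sym[OF M(2)] assms(1)]
      by blast
  qed
  then obtain M :: "'l set" where M: "A \<lesssim> M" "C \<lesssim> M" "M \<prec> L" by (elim exE conjE)
  have "infinite M"
    using lepoll_trans[OF assms(3)[unfolded infinite_le_lepoll] M(2)] by (simp only: infinite_le_lepoll)
  then show thesis using M by (rule that)
qed

lemma small_pi_character_contradiction:
  fixes X :: "'a topology" and C :: "'c set" and B :: "'a set set"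
  assumes GCH: "GCH_upto TYPE('a set set)"
    and X: "compact_space X" "Hausdorff_space X" "homogeneous_space X"
    and C: "infinite C" "\<And>F. cellular_family X F \<Longrightarrow> F \<lesssim> C" "C \<prec> B"
    and char: "\<forall>x\<in>topspace X. \<forall>B'. local_base X x B' \<longrightarrow> B \<lesssim> B'"
    and p: "p \<in> topspace X" "local_pi_base X p P" "P \<prec> B"
  shows False
proof -
  obtain M :: "'a set set" where M: "infinite M" "P \<lesssim> M" "C \<lesssim> M" "M \<prec> B"
    using exists_intermediate_set[OF p(3) C(3,1)] .
  have reg: "regular_space X" using X compact_Hausdorff_imp_regular_space by blast
  have "\<exists>P'. local_pi_base X x P' \<and> P' \<lesssim> M" if x: "x \<in> topspace X" for x
  proof -
    obtain f where f: "homeomorphic_map X X f" "f p = x"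
      using X(3) p(1) x by (auto simp: homogeneous_space_def)
    then have "local_pi_base X x ((`) f ` P)"
      using local_pi_base_homeomorphic_image[OF f(1) p(1,2)] by simp
    moreover have "(`) f ` P \<lesssim> M" using image_lepoll M(2) by (rule lepoll_trans)
    ultimately show ?thesis by blast
  qed
  then have pi: "\<forall>x\<in>topspace X. \<exists>P'. local_pi_base X x P' \<and> P' \<lesssim> M" by (rule ballI)
  have "\<forall>F. cellular_family X F \<longrightarrow> F \<lesssim> M"
    using lepoll_trans[OF C(2) M(3)] by blast
  from dense_subset_lepoll_Pow[OF reg M(1) pi this]
  obtain D where "D \<subseteq> topspace X" "D \<lesssim> Pow M" "\<forall>V. openin X V \<and> V \<noteq> {} \<longrightarrow> V \<inter> D \<noteq> {}"
    by (elim exE conjE)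
  then have D: "D \<lesssim> Pow M" "\<And>V. openin X V \<Longrightarrow> V \<noteq> {} \<Longrightarrow> V \<inter> D \<noteq> {}" by simp_all
  have small: "topspace X \<lesssim> Pow M"
    by (rule homogeneous_topspace_lepoll_Pow[OF X(2,3) M(1) p(1,2) M(2) D])
  \<comment> \<open>Singletons lift \<open>M\<close> by one type level, to the type at which
    \<open>GCH_upto\<close> is assumed.\<close>
  let ?M = "(\<lambda>U. {U}) ` M"
  have inj: "inj_on (\<lambda>U. {U}) M" by simp
  have M': "infinite ?M" "?M \<approx> M"
    using M(1) inj by (simp_all add: finite_image_iff inj_on_image_eqpoll_self)
  have "?M \<prec> B" using M'(2) M(4) by (rule eq_lesspoll_trans)
  then have "Pow ?M \<lesssim> B" by (rule GCH_upto_Pow_lepoll[OF GCH M'(1)])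
  moreover have "Pow M \<lesssim> Pow ?M"
  proof -
    have "inj_on (image (\<lambda>U. {U})) (Pow M)" using inj by (rule inj_on_image_Pow)
    moreover have "image (\<lambda>U. {U}) ` Pow M \<subseteq> Pow ?M" by blast
    ultimately show ?thesis by (auto simp: lepoll_def)
  qed
  ultimately have "topspace X \<lesssim> B" using lepoll_trans[OF lepoll_trans[OF small]] by blast
  moreover have "uncountable B" by (rule uncountable_of_lesspoll[OF C(1,3)])
  ultimately show False
    using not_topspace_lepoll_character[OF X(1,2) _ _ char] p(1) by blast
qed

theorem theorem1p7:
  fixes X :: "'a topology" and K :: "'k set" and C :: "'c set"
  assumes "GCH_upto TYPE('a set set)"
    and "compact_space X" and "Hausdorff_space X" and "homogeneous_space X"
    and "is_chiNt X K" and "is_cellularity X C"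
  shows "K \<lesssim> C"
proof (rule chiNt_lepoll[OF assms(5)])
  show C: "infinite C" using assms(6) by (simp add: is_cellularity_def)
  fix p assume p: "p \<in> topspace X"
  have "local_base X p {U. openin X U \<and> p \<in> U}" using p by (auto simp: local_base_def)
  \<comment> \<open>A local base of least size: \<open>B\<close> stands for the character and later
    also serves as index set for the neighbourhoods.\<close>
  then obtain B where B: "B \<in> {B. local_base X p B}" "\<And>B'. B' \<in> {B. local_base X p B} \<Longrightarrow> B \<lesssim> B'"
    using lepoll_minimal_set[of "{B. local_base X p B}"] by (metis empty_iff mem_Collect_eq)
  have move: "\<exists>f. homeomorphic_map X X f \<and> f x = y" if "x \<in> topspace X" "y \<in> topspace X" for x y
    using assms(4) that by (auto simp: homogeneous_space_def)
  have char: "\<forall>x\<in>topspace X. \<forall>B'. local_base X x B' \<longrightarrow> B \<lesssim> B'"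
  proof (intro ballI allI impI)
    fix x B' assume x: "x \<in> topspace X" "local_base X x B'"
    obtain f where f: "homeomorphic_map X X f" "f x = p" using move[OF x(1) p] by blast
    have "B \<lesssim> (`) f ` B'"
      using B(2) local_base_homeomorphic_image[OF f(1) x(2)] f(2) by simp
    then show "B \<lesssim> B'" using image_lepoll by (rule lepoll_trans)
  qed
  show "\<exists>B. local_base X p B \<and> op_like C B"
  proof (cases "B \<lesssim> C")
    case True
    then show ?thesis using op_like_local_base_of_lepoll[of X p B C] B(1) C by blast
  next
    case False
    then have CB: "C \<prec> B" by (simp add: not_lepoll_iff_lesspoll)
    have reg: "regular_space X" using assms(2,3) compact_Hausdorff_imp_regular_space by blast
    have unc: "uncountable B" by (rule uncountable_of_lesspoll[OF C CB])
    have pi: "\<forall>x\<in>topspace X. \<forall>P. local_pi_base X x P \<longrightarrow> B \<lesssim> P"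
    proof (intro ballI allI impI, rule ccontr)
      fix x P assume x: "x \<in> topspace X" "local_pi_base X x P" "\<not> B \<lesssim> P"
      then have "P \<prec> B" by (simp add: not_lepoll_iff_lesspoll)
      moreover have "F \<lesssim> C" if "cellular_family X F" for F
        using assms(6) that by (simp add: is_cellularity_def)
      ultimately show False
        using small_pi_character_contradiction[OF assms(1-4) C _ CB char x(1,2)] by blast
    qed
    have "topspace X \<noteq> {}" using p by blast
    \<comment> \<open>The special point \<open>q\<close> cannot be prescribed. Homogeneity carries
      \<open>B\<close> from \<open>p\<close> to \<open>q\<close> and the resulting base back to
      \<open>p\<close>.\<close>
    obtain q and N :: "'a set \<Rightarrow> 'a set" where q: "q \<in> topspace X"
      and N: "\<And>i. i \<in> B \<Longrightarrow> openin X (N i) \<and> q \<in> N i"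
        "\<And>W. openin X W \<Longrightarrow> q \<in> W \<Longrightarrow> finite {i \<in> B. W \<subseteq> N i}"
      by (rule independent_neighbourhoods[OF assms(2) reg \<open>topspace X \<noteq> {}\<close> unc pi]) blast
    obtain f where f: "homeomorphic_map X X f" "f p = q" using move[OF p q] by blast
    have "local_base X q ((`) f ` B)"
      using local_base_homeomorphic_image[OF f(1)] B(1) f(2) by blast
    from op_like_local_base_of_independent[OF this image_lepoll N C]
    obtain B' where B': "local_base X q B'" "op_like C B'" by blast
    obtain g where g: "homeomorphic_map X X g" "g q = p" using move[OF q p] by blast
    show ?thesis
      using local_base_homeomorphic_image[OF g(1) B'(1)] op_like_homeomorphic_image[OF g(1) B'] g(2)
      by auto
  qed
qed

end
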